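(* Let $\alpha\in(0,1)$ and $\lambda\in[0,1]$. Let $\Omega_1$ be the set of feasible route flow vectors and, for $\mathbf{f}\in\Omega_1$, let $\psi_k^{rs}(\mathbf{f})$ be the $\alpha$-reliable combined mean travel time (with weight $\lambda$) of route $k\in K^{rs}$ under the flow $\mathbf{f}$. Let $\mathbf{f}^*\in\Omega_1$ and, for each $r\in R$, $s\in S$, let $\pi_\alpha^{rs}=\min_{k\in K^{rs}}\psi_k^{rs}(\mathbf{f}^* )$. Then $\mathbf{f}^*$ is a Wardropian combined mean traffic equilibrium, i.e. $$f_k^{rs*}\left(\psi_k^{rs}(\mathbf{f}^* )-\pi_\alpha^{rs}\right)=0,\qquad \psi_k^{rs}(\mathbf{f}^* )-\pi_\alpha^{rs}\ge 0,\qquad f_k^{rs*}\ge 0\qquad\text{for all } k\in K^{rs},\ r\in R,\ s\in S,$$ if and only if $\mathbf{f}^*$ solves the variational inequality $$\sum_{r\in R}\sum_{s\in S}\sum_{k\in K^{rs}}\psi_k^{rs}(\mathbf{f}^* )\left(f_k^{rs}-f_k^{rs*}\right)\ge 0\qquad\text{for all }\mathbf{f}=(f_k^{rs})\in\Omega_1.$$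
   Context: Setting: a strongly connected transportation network $G=(N,A)$ with node set $N$ and link set $A$; $R,S\subseteq N$ are the sets of origins and destinations; $q^{rs}\ge 0$ is the given travel demand from $r\in R$ to $s\in S$; $K^{rs}$ is the finite nonempty set of routes from $r$ to $s$; $\delta_{ak}^{rs}=1$ if route $k\in K^{rs}$ uses link $a$, and $0$ otherwise. A route flow vector is $\mathbf{f}=(f_k^{rs})_{r\in R,\,s\in S,\,k\in K^{rs}}$. The feasible set is $$\Omega_1=\Big\{\mathbf{f}:\ \sum_{k\in K^{rs}}f_k^{rs}=q^{rs}\ \ \forall r\in R,\,s\in S;\quad f_k^{rs}\ge 0\ \ \forall k\in K^{rs},\,r\in R,\,s\in S\Big\},$$ with associated link flows $v_a=\sum_r\sum_s\sum_k f_k^{rs}\delta_{ak}^{rs}$ for $a\in A$. Route costs: the random link travel times $T_a$ have distributions depending on the link flows (hence on $\mathbf{f}$), and the random route travel time is $T_k^{rs}=\sum_{a\in A}T_a\delta_{ak}^{rs}$, assumed to have finite expectation for every $\mathbf{f}\in\Omega_1$. Put $\xi_k^{rs}(\alpha)=\min\{\xi\in\mathbb{R}:\Pr(T_k^{rs}\le\xi)\ge\alpha\}$ (percentile travel time), $\varphi_k^{rs}(\alpha)=E(T_k^{rs}\mid T_k^{rs}\le\xi_k^{rs}(\alpha))$ (mean-below travel time) and $\eta_k^{rs}(\alpha)=E(T_k^{rs}\mid T_k^{rs}\ge\xi_k^{rs}(\alpha))$ (mean-excess travel time). The $\alpha$-reliable combined mean travel time of route $k$ under flow $\mathbf{f}$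 is the convex combination $$\psi_k^{rs}(\mathbf{f})=\lambda\,\varphi_k^{rs}(\alpha)+(1-\lambda)\,\eta_k^{rs}(\alpha),$$ a real-valued function on $\Omega_1$. *)

theory Defs
  imports "HOL-Probability.Probability" "Graph_Theory.Graph_Theory"
begin

text \<open>
  A route is the list of the arcs (links) it traverses.  A route flow vector assigns
  to an origin r, a destination s and a route k in the route set K r s the flow \<open>f r s k\<close>;
  its values at other arguments play no role in any of the notions below.
\<close>

type_synonym ('v, 'e) route_flow = "'v \<Rightarrow> 'v \<Rightarrow> 'e list \<Rightarrow> real"

definition incidence :: "'e \<Rightarrow> 'e list \<Rightarrow> real" where
  "incidence a k = (if a \<in> set k then 1 else 0)"

definition feasible_flows ::
    "'v set \<Rightarrow> 'v set \<Rightarrow> ('v \<Rightarrow> 'v \<Rightarrow> 'e list set) \<Rightarrow> ('v \<Rightarrow> 'v \<Rightarrow> real) \<Rightarrow> ('v, 'e) route_flow set"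
  where
  "feasible_flows R S K q =
    {f. (\<forall>r\<in>R. \<forall>s\<in>S. (\<Sum>k\<in>K r s. f r s k) = q r s) \<and>
        (\<forall>r\<in>R. \<forall>s\<in>S. \<forall>k\<in>K r s. f r s k \<ge> 0)}"

definition link_flow ::
    "'v set \<Rightarrow> 'v set \<Rightarrow> ('v \<Rightarrow> 'v \<Rightarrow> 'e list set) \<Rightarrow> ('v, 'e) route_flow \<Rightarrow> 'e \<Rightarrow> real"
  where
  "link_flow R S K f a = (\<Sum>r\<in>R. \<Sum>s\<in>S. \<Sum>k\<in>K r s. f r s k * incidence a k)"

definition route_time ::
    "('v, 'e) pre_digraph \<Rightarrow> ('e \<Rightarrow> 'w \<Rightarrow> real) \<Rightarrow> 'e list \<Rightarrow> 'w \<Rightarrow> real"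
  where
  "route_time G T k \<omega> = (\<Sum>a\<in>arcs G. T a \<omega> * incidence a k)"

text \<open>
  For a real random variable and \<open>0 < \<alpha> < 1\<close> the minimum below exists, since the distribution
  function is right-continuous with limits 0 and 1.  The two events conditioned on in the
  subsequent definitions then have probability at least \<open>\<alpha>\<close> and \<open>1 - \<alpha>\<close>, so that
  \<open>uniform_measure\<close> is the conditional probability measure given the event.
\<close>

definition percentile :: "'w measure \<Rightarrow> ('w \<Rightarrow> real) \<Rightarrow> real \<Rightarrow> real" where
  "percentile M X \<alpha> = (LEAST \<xi>. measure M {\<omega> \<in> space M. X \<omega> \<le> \<xi>} \<ge> \<alpha>)"

definition mean_below :: "'w measure \<Rightarrow> ('w \<Rightarrow> real) \<Rightarrow> real \<Rightarrow> real" where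
  "mean_below M X \<alpha> =
    integral\<^sup>L (uniform_measure M {\<omega> \<in> space M. X \<omega> \<le> percentile M X \<alpha>}) X"

definition mean_excess :: "'w measure \<Rightarrow> ('w \<Rightarrow> real) \<Rightarrow> real \<Rightarrow> real" where
  "mean_excess M X \<alpha> =
    integral\<^sup>L (uniform_measure M {\<omega> \<in> space M. X \<omega> \<ge> percentile M X \<alpha>}) X"

definition combined_mean :: "'w measure \<Rightarrow> ('w \<Rightarrow> real) \<Rightarrow> real \<Rightarrow> real \<Rightarrow> real" where
  "combined_mean M X \<alpha> l = l * mean_below M X \<alpha> + (1 - l) * mean_excess M X \<alpha>"

text \<open>
  For a vector v of link flows, \<open>M v\<close> is the probability space on which the link travel
  times \<open>T v a\<close> live; their joint distribution may thus depend on v in an arbitrary way.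
\<close>

definition combined_mean_travel_time ::
    "('v, 'e) pre_digraph \<Rightarrow> 'v set \<Rightarrow> 'v set \<Rightarrow> ('v \<Rightarrow> 'v \<Rightarrow> 'e list set) \<Rightarrow>
     (('e \<Rightarrow> real) \<Rightarrow> 'w measure) \<Rightarrow> (('e \<Rightarrow> real) \<Rightarrow> 'e \<Rightarrow> 'w \<Rightarrow> real) \<Rightarrow> real \<Rightarrow> real \<Rightarrow>
     ('v, 'e) route_flow \<Rightarrow> 'e list \<Rightarrow> real"
  where
  "combined_mean_travel_time G R S K M T \<alpha> l f k =
    (let v = link_flow R S K f in combined_mean (M v) (route_time G (T v) k) \<alpha> l)"

definition wardrop_equilibrium ::
    "'v set \<Rightarrow> 'v set \<Rightarrow> ('v \<Rightarrow> 'v \<Rightarrow> 'e list set) \<Rightarrow>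
     (('v, 'e) route_flow \<Rightarrow> 'e list \<Rightarrow> real) \<Rightarrow> ('v, 'e) route_flow \<Rightarrow> bool"
  where
  "wardrop_equilibrium R S K \<psi> f \<longleftrightarrow>
    (\<forall>r\<in>R. \<forall>s\<in>S. \<forall>k\<in>K r s.
       let p = Min (\<psi> f ` K r s)
       in f r s k * (\<psi> f k - p) = 0 \<and> \<psi> f k - p \<ge> 0 \<and> f r s k \<ge> 0)"

end

theory Submission
  imports Defs
begin

text \<open>
  The route costs at \<open>fstar\<close> are constants of the problem, so their probabilistic origin plays no
  role.  Feasibility constrains each origin-destination pair separately, hence the variational
  inequality splits into one inequality per pair.  For a single pair with minimal cost m, all
  competitors y have the same total as x, so replacing c by \<open>c - m\<close> does not change the inequality;
  it then reads \<open>\<Sum> (c - m) * x \<le> \<Sum> (c - m) * y\<close>, and the right-hand side attains its minimum 0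
  when all flow is put on a cheapest route.
\<close>

lemma complementary_slackness_iff_variational_inequality:
  fixes c x :: "'a \<Rightarrow> real"
  assumes fin: "finite I" and ne: "I \<noteq> {}" and x: "\<And>k. k \<in> I \<Longrightarrow> x k \<ge> 0"
  shows "(\<forall>k\<in>I. x k * (c k - Min (c ` I)) = 0) \<longleftrightarrow>
    (\<forall>y. (\<forall>k\<in>I. y k \<ge> 0) \<longrightarrow> sum y I = sum x I \<longrightarrow> (\<Sum>k\<in>I. c k * (y k - x k)) \<ge> 0)"
    (is "?slack \<longleftrightarrow> ?VI")
proof -
  define m where "m = Min (c ` I)"
  have m_le: "m \<le> c k" if "k \<in> I" for k
    using fin that by (simp add: m_def)
  have shift: "(\<Sum>k\<in>I. c k * (y k - x k)) = (\<Sum>k\<in>I. y k * (c k - m)) - (\<Sum>k\<in>I. x k * (c k - m))"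
    if "sum y I = sum x I" for y
  proof -
    have "(\<Sum>k\<in>I. m * y k) = (\<Sum>k\<in>I. m * x k)"
      using that by (simp flip: sum_distrib_left)
    then show ?thesis
      by (simp add: algebra_simps sum_subtractf)
  qed
  show ?thesis
  proof
    assume slack: ?slack
    show ?VI
    proof (intro allI impI)
      fix y assume y: "\<forall>k\<in>I. y k \<ge> 0" and tot: "sum y I = sum x I"
      \<comment> \<open>Measured by the excess costs \<open>c k - m\<close>, the flow
        \<open>x\<close> costs nothing, while a nonnegative \<open>y\<close> cannot cost less than
        0.\<close>
      have "(\<Sum>k\<in>I. x k * (c k - m)) = 0"
        unfolding m_def using slack by (rule sum.neutral)
      moreover have "(\<Sum>k\<in>I. y k * (c k - m)) \<ge> 0"
        using y m_le by (intro sum_nonneg) simp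
      ultimately show "(\<Sum>k\<in>I. c k * (y k - x k)) \<ge> 0"
        by (simp add: shift[OF tot])
    qed
  next
    assume VI: ?VI
    have "m \<in> c ` I"
      using fin ne by (simp add: m_def)
    then obtain k0 where k0: "k0 \<in> I" "c k0 = m"
      by auto
    \<comment> \<open>The competitor to test: the whole total of \<open>x\<close> moved to the
      cheapest index \<open>k0\<close>. Its excess cost is 0, and it is nonnegative because
      \<open>x\<close> is.\<close>
    define y where "y k = (if k = k0 then sum x I else 0)" for k
    have tot: "sum y I = sum x I"
      using fin k0 by (simp add: y_def)
    have "\<forall>k\<in>I. y k \<ge> 0"
      using x by (simp add: y_def sum_nonneg)
    with VI tot have "(\<Sum>k\<in>I. c k * (y k - x k)) \<ge> 0"
      by blast
    moreover have "(\<Sum>k\<in>I. y k * (c k - m)) = 0"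
      using k0 by (intro sum.neutral) (simp add: y_def)
    ultimately have "(\<Sum>k\<in>I. x k * (c k - m)) \<le> 0"
      by (simp add: shift[OF tot])
    \<comment> \<open>A sum of nonnegative terms that is at most 0 has only zero terms, which is
      complementary slackness.\<close>
    moreover have nonneg: "x k * (c k - m) \<ge> 0" if "k \<in> I" for k
      using x m_le that by simp
    ultimately have "(\<Sum>k\<in>I. x k * (c k - m)) = 0"
      by (meson order.antisym sum_nonneg)
    then show ?slack
      using sum_nonneg_eq_0_iff[OF fin, of "\<lambda>k. x k * (c k - m)"] nonneg by (simp add: m_def)
  qed
qed

text \<open>The feasible set is a product over the pairs and the cost \<open>c\<close> is fixed, so
  one pair can be varied alone. The demand \<open>q\<close> drops out on the right because
  \<open>g\<close> already meets it.\<close>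

lemma variational_inequality_iff_pairwise:
  fixes c :: "'e list \<Rightarrow> real"
  assumes fin: "finite R" "finite S" and g: "g \<in> feasible_flows R S K q"
  shows "(\<forall>f \<in> feasible_flows R S K q.
      (\<Sum>r\<in>R. \<Sum>s\<in>S. \<Sum>k\<in>K r s. c k * (f r s k - g r s k)) \<ge> 0) \<longleftrightarrow>
    (\<forall>r\<in>R. \<forall>s\<in>S. \<forall>y. (\<forall>k\<in>K r s. y k \<ge> 0) \<longrightarrow> sum y (K r s) = sum (g r s) (K r s) \<longrightarrow>
      (\<Sum>k\<in>K r s. c k * (y k - g r s k)) \<ge> 0)"
    (is "?VI \<longleftrightarrow> ?pairwise")
proof
  assume VI: ?VI
  show ?pairwise
  proof (intro ballI allI impI)
    fix r s y
    assume rs: "r \<in> R" "s \<in> S" and y: "\<forall>k\<in>K r s. y k \<ge> 0"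
      and tot: "sum y (K r s) = sum (g r s) (K r s)"
    \<comment> \<open>Replace \<open>g\<close> by \<open>y\<close> on the pair \<open>(r, s)\<close>
      only; every other pair then contributes 0 to the triple sum.\<close>
    define f where "f r' s' = (if r' = r \<and> s' = s then y else g r' s')" for r' s'
    have "f \<in> feasible_flows R S K q"
      using g y tot rs by (auto simp: feasible_flows_def f_def)
    with VI have "0 \<le> (\<Sum>r'\<in>R. \<Sum>s'\<in>S. \<Sum>k\<in>K r' s'. c k * (f r' s' k - g r' s' k))"
      by blast
    \<comment> \<open>The condition is split into nested conditionals so that the sum over
      \<open>s'\<close> and then the sum over \<open>r'\<close> each collapse to a single
      term.\<close>
    also have "\<dots> = (\<Sum>r'\<in>R. \<Sum>s'\<in>S. if r' = r then if s' = s then \<Sum>k\<in>K r s. c k * (y k - g r s k) else 0 else 0)"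
      by (intro sum.cong refl) (auto simp: f_def)
    also have "\<dots> = (\<Sum>r'\<in>R. if r' = r then \<Sum>k\<in>K r s. c k * (y k - g r s k) else 0)"
      using fin rs by (intro sum.cong refl) simp
    also have "\<dots> = (\<Sum>k\<in>K r s. c k * (y k - g r s k))"
      using fin rs by simp
    finally show "(\<Sum>k\<in>K r s. c k * (y k - g r s k)) \<ge> 0" .
  qed
next
  assume ?pairwise
  show ?VI
  proof (rule ballI, rule sum_nonneg, rule sum_nonneg)
    fix f r s
    assume f: "f \<in> feasible_flows R S K q" and rs: "r \<in> R" "s \<in> S"
    \<comment> \<open>Both totals equal \<open>q r s\<close>, so \<open>f r s\<close> is an
      admissible competitor for this pair.\<close>
    have "\<forall>k\<in>K r s. f r s k \<ge> 0" "sum (f r s) (K r s) = sum (g r s) (K r s)"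
      using f g rs by (simp_all add: feasible_flows_def)
    with \<open>?pairwise\<close> rs show "(\<Sum>k\<in>K r s. c k * (f r s k - g r s k)) \<ge> 0"
      by blast
  qed
qed

theorem proposition2:
  fixes G :: "('v, 'e) pre_digraph"
    and R S :: "'v set"
    and q :: "'v \<Rightarrow> 'v \<Rightarrow> real"
    and K :: "'v \<Rightarrow> 'v \<Rightarrow> 'e list set"
    and M :: "('e \<Rightarrow> real) \<Rightarrow> 'w measure"
    and T :: "('e \<Rightarrow> real) \<Rightarrow> 'e \<Rightarrow> 'w \<Rightarrow> real"
    and \<alpha> l :: real
    and \<psi> :: "('v, 'e) route_flow \<Rightarrow> 'e list \<Rightarrow> real"
    and fstar :: "('v, 'e) route_flow"
  assumes network: "fin_digraph G" "strongly_connected G"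
    and nodes: "R \<subseteq> verts G" "S \<subseteq> verts G"
    and demand: "\<And>r s. r \<in> R \<Longrightarrow> s \<in> S \<Longrightarrow> q r s \<ge> 0"
    and routes_finite: "\<And>r s. r \<in> R \<Longrightarrow> s \<in> S \<Longrightarrow> finite (K r s)"
    and routes_nonempty: "\<And>r s. r \<in> R \<Longrightarrow> s \<in> S \<Longrightarrow> K r s \<noteq> {}"
    and routes: "\<And>r s k. r \<in> R \<Longrightarrow> s \<in> S \<Longrightarrow> k \<in> K r s \<Longrightarrow> pre_digraph.awalk G r k s"
    and prob: "\<And>f. f \<in> feasible_flows R S K q \<Longrightarrow> prob_space (M (link_flow R S K f))"
    and link_times: "\<And>f a. f \<in> feasible_flows R S K q \<Longrightarrow> a \<in> arcs G \<Longrightarrow>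
      T (link_flow R S K f) a \<in> borel_measurable (M (link_flow R S K f))"
    and finite_expectation: "\<And>f r s k. f \<in> feasible_flows R S K q \<Longrightarrow>
      r \<in> R \<Longrightarrow> s \<in> S \<Longrightarrow> k \<in> K r s \<Longrightarrow>
      integrable (M (link_flow R S K f)) (route_time G (T (link_flow R S K f)) k)"
    and alpha: "0 < \<alpha>" "\<alpha> < 1"
    and lambda: "0 \<le> l" "l \<le> 1"
    and cost: "\<psi> = combined_mean_travel_time G R S K M T \<alpha> l"
    and feasible: "fstar \<in> feasible_flows R S K q"
  shows "wardrop_equilibrium R S K \<psi> fstar \<longleftrightarrow>
    (\<forall>f \<in> feasible_flows R S K q.
       (\<Sum>r\<in>R. \<Sum>s\<in>S. \<Sum>k\<in>K r s. \<psi> fstar k * (f r s k - fstar r s k)) \<ge> 0)"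
proof -
  interpret fin_digraph G
    by (rule network)
  have fin: "finite R" "finite S"
    using nodes finite_subset finite_verts by blast+
  have nonneg: "fstar r s k \<ge> 0" if "r \<in> R" "s \<in> S" "k \<in> K r s" for r s k
    using feasible that by (simp add: feasible_flows_def)
  \<comment> \<open>The two sign conditions hold automatically: \<open>Min\<close> is a lower bound
    on a finite set, and feasibility makes the flows nonnegative. Only the product condition
    remains.\<close>
  have "wardrop_equilibrium R S K \<psi> fstar \<longleftrightarrow>
    (\<forall>r\<in>R. \<forall>s\<in>S. \<forall>k\<in>K r s. fstar r s k * (\<psi> fstar k - Min (\<psi> fstar ` K r s)) = 0)"
    using nonneg routes_finite by (simp add: wardrop_equilibrium_def Let_def)
  also have "\<dots> \<longleftrightarrow> (\<forall>r\<in>R. \<forall>s\<in>S. \<forall>y. (\<forall>k\<in>K r s. y k \<ge> 0) \<longrightarrow>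
      sum y (K r s) = sum (fstar r s) (K r s) \<longrightarrow>
      (\<Sum>k\<in>K r s. \<psi> fstar k * (y k - fstar r s k)) \<ge> 0)"
    by (intro ball_cong refl complementary_slackness_iff_variational_inequality
        routes_finite routes_nonempty nonneg)
  also have "\<dots> \<longleftrightarrow> (\<forall>f \<in> feasible_flows R S K q.
       (\<Sum>r\<in>R. \<Sum>s\<in>S. \<Sum>k\<in>K r s. \<psi> fstar k * (f r s k - fstar r s k)) \<ge> 0)"
    by (rule variational_inequality_iff_pairwise[OF fin feasible, symmetric])
  finally show ?thesis .
qed

end
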